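(* For every semigroup $(S,\cdot)$, the following statements (1)–(6) are equivalent, and each of them implies statements (7) and (8). (1) For every $a,b\in S$ there exists $x\in S$ such that $ax=bx$. (2) For every $H\in{\mathcal P}_f(S)$ there exists $x\in S$ such that $ax=bx$ for all $a,b\in H$. (3) The minimal left ideals of $\beta S$ are singletons. (4) For every $p\in K(\beta S)$ and every $q\in\beta S$, $qp=p$. (5) $K(\beta S)$ is a right zero semigroup, i.e. every element of $K(\beta S)$ is a right zero of $K(\beta S)$. (6) $S$ satisfies the Strong F\o lner Condition and $d(A)\in\{0,1\}$ for every $A\subseteq S$. (7) Every member of $K(\beta S)$ is idempotent. (8) $S$ satisfies the Strong F\o lner Condition and $K(\beta S)=\Delta(S)$.
   Context: ${\mathcal P}_f(S)$ denotes the set of finite nonempty subsets of $S$. $\beta S$ is the set of ultrafilters on $S$ (points of $S$ identified with principal ultrafilters), a compact right topological semigroup with the operation extending that of $S$ given by: $A\in pq$ iff $\{s\in S:s^{-1}A\in q\}\in p$, where $s^{-1}A=\{t\in S:st\in A\}$. $K(\beta S)$ is the smallest two sided ideal of $\beta S$ (the union of all minimal left ideals). $S$ satisfies the Strong F\o lner Condition (SFC) if for every $H\in{\mathcal P}_f(S)$ and $\epsilon>0$ there is $K\in{\mathcal P}_f(S)$ with $|K\setminus sK|<\epsilon|K|$ for all $s\in H$. For such $S$ and $A\subseteq S$, $d(A)$ is the supremum of $\alpha\in[0,1]$ such that for every $H\in{\mathcal P}_f(S)$ and $\epsilon>0$ there is $K\in{\mathcal P}_f(S)$ with $|K\setminus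 sK|<\epsilon|K|$ for all $s\in H$ and $|A\cap K|\ge\alpha|K|$; and $\Delta(S)=\{p\in\beta S:d(A)>0$ for all $A\in p\}$. *)

theory Defs
  imports Complex_Main
begin

section \<open>The semigroup of ultrafilters on a semigroup\<close>

typedef 'a ultrafilter =
  "{F :: 'a filter. F \<noteq> bot \<and> (\<forall>P. eventually P F \<or> eventually (\<lambda>x. \<not> P x) F)}"
  morphisms filter_of Abs_ultrafilter
proof -
  have "principal {undefined :: 'a} \<noteq> bot"
    by (simp add: principal_eq_bot_iff)
  moreover have "eventually P (principal {undefined :: 'a})
      \<or> eventually (\<lambda>x. \<not> P x) (principal {undefined})" for P
    by (auto simp: eventually_principal)
  ultimately show ?thesis by blast
qed

setup_lifting type_definition_ultrafilter

definition members :: "'a ultrafilter \<Rightarrow> 'a set set" where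
  "members p = {A. eventually (\<lambda>x. x \<in> A) (filter_of p)}"

lemma ultrafilter_eqI:
  assumes "members p = members q"
  shows "p = q"
proof -
  have "eventually P (filter_of p) = eventually P (filter_of q)" for P
  proof -
    have "{x. P x} \<in> members p \<longleftrightarrow> {x. P x} \<in> members q"
      using assms by simp
    then show ?thesis by (simp add: members_def)
  qed
  then show ?thesis
    by (simp add: filter_eq_iff filter_of_inject[symmetric])
qed

definition filter_times :: "'a::semigroup_mult filter \<Rightarrow> 'a filter \<Rightarrow> 'a filter" where
  "filter_times F G = Abs_filter (\<lambda>P. eventually (\<lambda>s. eventually (\<lambda>t. P (s * t)) G) F)"

lemma eventually_filter_times:
  "eventually P (filter_times F G) \<longleftrightarrow> eventually (\<lambda>s. eventually (\<lambda>t. P (s * t)) G) F"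
  unfolding filter_times_def
proof (rule eventually_Abs_filter, rule is_filter.intro)
  show "eventually (\<lambda>s. eventually (\<lambda>t. True) G) F" by simp
next
  fix P Q :: "'a \<Rightarrow> bool"
  assume "eventually (\<lambda>s. eventually (\<lambda>t. P (s * t)) G) F"
    and "eventually (\<lambda>s. eventually (\<lambda>t. Q (s * t)) G) F"
  then show "eventually (\<lambda>s. eventually (\<lambda>t. P (s * t) \<and> Q (s * t)) G) F"
    by eventually_elim (rule eventually_conj)
next
  fix P Q :: "'a \<Rightarrow> bool"
  assume "\<forall>x. P x \<longrightarrow> Q x"
    and "eventually (\<lambda>s. eventually (\<lambda>t. P (s * t)) G) F"
  from this(2) show "eventually (\<lambda>s. eventually (\<lambda>t. Q (s * t)) G) F"
    by (rule eventually_mono) (use \<open>\<forall>x. P x \<longrightarrow> Q x\<close> in \<open>auto elim: eventually_mono\<close>)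
qed

instantiation ultrafilter :: (semigroup_mult) semigroup_mult
begin

lift_definition times_ultrafilter :: "'a ultrafilter \<Rightarrow> 'a ultrafilter \<Rightarrow> 'a ultrafilter"
  is filter_times
proof (intro conjI allI)
  fix F G :: "'a filter"
  assume F: "F \<noteq> bot \<and> (\<forall>P. eventually P F \<or> eventually (\<lambda>x. \<not> P x) F)"
    and G: "G \<noteq> bot \<and> (\<forall>P. eventually P G \<or> eventually (\<lambda>x. \<not> P x) G)"
  show "filter_times F G \<noteq> bot"
    using F G by (simp add: trivial_limit_def eventually_filter_times)
  fix P :: "'a \<Rightarrow> bool"
  show "eventually P (filter_times F G) \<or> eventually (\<lambda>x. \<not> P x) (filter_times F G)"
  proof (cases "eventually (\<lambda>s. eventually (\<lambda>t. P (s * t)) G) F")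
    case True
    then show ?thesis by (simp add: eventually_filter_times)
  next
    case False
    then have "eventually (\<lambda>s. \<not> eventually (\<lambda>t. P (s * t)) G) F"
      using F by blast
    then have "eventually (\<lambda>s. eventually (\<lambda>t. \<not> P (s * t)) G) F"
      by (rule eventually_mono) (use G in blast)
    then show ?thesis by (simp add: eventually_filter_times)
  qed
qed

instance
proof
  fix p q r :: "'a ultrafilter"
  show "p * q * r = p * (q * r)"
    by transfer (simp add: filter_eq_iff eventually_filter_times mult.assoc)
qed

end

lemma mem_members_times:
  "A \<in> members (p * q) \<longleftrightarrow> {s. {t. s * t \<in> A} \<in> members q} \<in> members p"
  by (simp add: members_def times_ultrafilter.rep_eq eventually_filter_times)


section \<open>Ideals of a semigroup\<close>

definition left_ideal :: "'a::semigroup_mult set \<Rightarrow> bool" where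
  "left_ideal L \<longleftrightarrow> L \<noteq> {} \<and> (\<forall>s. \<forall>x\<in>L. s * x \<in> L)"

definition right_ideal :: "'a::semigroup_mult set \<Rightarrow> bool" where
  "right_ideal R \<longleftrightarrow> R \<noteq> {} \<and> (\<forall>s. \<forall>x\<in>R. x * s \<in> R)"

definition two_sided_ideal :: "'a::semigroup_mult set \<Rightarrow> bool" where
  "two_sided_ideal I \<longleftrightarrow> left_ideal I \<and> right_ideal I"

definition minimal_left_ideal :: "'a::semigroup_mult set \<Rightarrow> bool" where
  "minimal_left_ideal L \<longleftrightarrow> left_ideal L \<and> (\<forall>M. left_ideal M \<and> M \<subseteq> L \<longrightarrow> M = L)"

text \<open>Meaningful only if a smallest two-sided ideal exists, as it does in the semigroup of
  ultrafilters, where it is the union of all minimal left ideals.\<close>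

definition smallest_ideal :: "'a::semigroup_mult set" where
  "smallest_ideal = (LEAST I. two_sided_ideal I)"

definition right_zero_of :: "'a::semigroup_mult set \<Rightarrow> 'a \<Rightarrow> bool" where
  "right_zero_of T z \<longleftrightarrow> z \<in> T \<and> (\<forall>x\<in>T. x * z = z)"


section \<open>Folner conditions and density\<close>

definition folner_set :: "'a::semigroup_mult set \<Rightarrow> real \<Rightarrow> 'a set \<Rightarrow> bool" where
  "folner_set H \<epsilon> K \<longleftrightarrow> finite K \<and> K \<noteq> {} \<and>
     (\<forall>s\<in>H. real (card (K - (\<lambda>t. s * t) ` K)) < \<epsilon> * real (card K))"

definition strong_folner_condition :: "'a::semigroup_mult itself \<Rightarrow> bool" where
  "strong_folner_condition _ \<longleftrightarrow>
     (\<forall>(H :: 'a set) \<epsilon>. finite H \<and> H \<noteq> {} \<and> \<epsilon> > 0 \<longrightarrow> (\<exists>K. folner_set H \<epsilon> K))"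

text \<open>Under the strong Folner condition the set below contains 0. Without it the set is empty
  and the density is not meaningful.\<close>

definition folner_density :: "'a::semigroup_mult set \<Rightarrow> real" where
  "folner_density A = Sup {\<alpha>. 0 \<le> \<alpha> \<and> \<alpha> \<le> 1 \<and>
     (\<forall>H \<epsilon>. finite H \<and> H \<noteq> {} \<and> \<epsilon> > 0 \<longrightarrow>
        (\<exists>K. folner_set H \<epsilon> K \<and> real (card (A \<inter> K)) \<ge> \<alpha> * real (card K)))}"

definition Delta :: "'a::semigroup_mult ultrafilter set" where
  "Delta = {p. \<forall>A\<in>members p. folner_density A > 0}"

end

theory Submission
  imports Defs
begin

text \<open>Condition (1) is equivalent to: every finite subset of \<open>S\<close> has a common fixed point under left
  multiplication. Hence the sets \<open>{z. s * z = z}\<close> have the finite intersection property, and an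
  ultrafilter containing all of them is a right zero of \<open>\<beta>S\<close>. The set of right zeros of \<open>\<beta>S\<close>, if
  nonempty, is its smallest ideal. Conversely, by Katetov's three-set lemma an ultrafilter
  \<open>p\<close> with \<open>s p = p\<close> contains the set of fixed points of \<open>s\<close>, so a right zero of \<open>\<beta>S\<close>
  yields common fixed points. The same lemma shows that under (6) the points moved by \<open>s\<close> have
  density 0. Finally, if all elements of \<open>H\<close> fix \<open>z\<close>, they fix \<open>z K\<close> pointwise, and for a Folner
  set \<open>K\<close> this is nearly all of \<open>K\<close>; so a set of positive density contains common fixed
  points of \<open>H\<close>, and singletons of such points witness density 1.\<close>

section \<open>Katetov's three-set lemma\<close>

text \<open>Two points are connected if their forward orbits meet, and \<open>r\<close> picks a root
  in each component. Here \<open>n x\<close> is the first place where the orbit of \<open>x\<close>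
  hits the orbit of the root, and \<open>m x\<close> is the number of steps \<open>x\<close> needs
  to get there. The parity of \<open>m x + n x\<close> alternates along \<open>f\<close> except
  where the orbit of the root closes up into a cycle; that point receives the third colour.\<close>

lemma three_colouring:
  fixes f :: "'a \<Rightarrow> 'a"
  obtains c :: "'a \<Rightarrow> nat" where "\<And>x. c x < 3" and "\<And>x. f x \<noteq> x \<Longrightarrow> c (f x) \<noteq> c x"
proof -
  define r where "r x = (SOME y. \<exists>n m. (f ^^ m) x = (f ^^ n) y)" for x
  define n where "n x = (LEAST n. \<exists>m. (f ^^ m) x = (f ^^ n) (r x))" for x
  define m where "m x = (LEAST m. (f ^^ m) x = (f ^^ n x) (r x))" for x
  \<comment> \<open>A special point lies on the orbit of the root and its image comes back to it: it
    is where that orbit enters its cycle.\<close>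
  define special where "special x \<longleftrightarrow> m x = 0 \<and> n (f x) = n x" for x
  define c where "c x = (if special x then 2 else (m x + n x) mod 2)" for x
  \<comment> \<open>The predicates under \<open>SOME\<close> for \<open>f x\<close> and for
    \<open>x\<close> agree, so both points get the same root.\<close>
  have "(\<exists>n m. (f ^^ m) (f x) = (f ^^ n) y) \<longleftrightarrow> (\<exists>n m. (f ^^ m) x = (f ^^ n) y)" for x y
  proof
    assume "\<exists>n m. (f ^^ m) (f x) = (f ^^ n) y"
    then obtain i j where "(f ^^ j) (f x) = (f ^^ i) y" by blast
    then have "(f ^^ Suc j) x = (f ^^ i) y" by (simp only: funpow_Suc_right o_apply)
    then show "\<exists>n m. (f ^^ m) x = (f ^^ n) y" by blast
  next
    assume "\<exists>n m. (f ^^ m) x = (f ^^ n) y"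
    then obtain i j where "(f ^^ j) x = (f ^^ i) y" by blast
    then have "(f ^^ j) (f x) = (f ^^ Suc i) y" by (simp add: funpow_swap1[symmetric])
    then show "\<exists>n m. (f ^^ m) (f x) = (f ^^ n) y" by blast
  qed
  then have r_f: "r (f x) = r x" for x
    unfolding r_def by presburger
  have "\<exists>n m. (f ^^ m) x = (f ^^ n) (r x)" for x
    unfolding r_def by (rule someI_ex) blast
  then have "\<exists>m. (f ^^ m) x = (f ^^ n x) (r x)" for x
    unfolding n_def by (rule LeastI_ex)
  then have m: "(f ^^ m x) x = (f ^^ n x) (r x)" for x
    unfolding m_def by (rule LeastI_ex)
  have n_le: "n x \<le> i" if "(f ^^ j) x = (f ^^ i) (r x)" for x i j
    unfolding n_def by (rule Least_le) (use that in blast)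
  have m_le: "m x \<le> j" if "(f ^^ j) x = (f ^^ n x) (r x)" for x j
    unfolding m_def by (rule Least_le) (fact that)
  have n_mono: "n x \<le> n (f x)" for x
    using m[of "f x"] n_le[of "Suc (m (f x))" x] by (simp add: r_f funpow_swap1)
  have "c (f x) \<noteq> c x" if "f x \<noteq> x" for x
  proof (cases "special x")
    case True
    then have "(f ^^ m (f x)) (f x) = x"
      using m[of x] m[of "f x"] by (simp add: special_def r_f)
    then have "m (f x) \<noteq> 0"
      using that by (intro notI) simp
    then have "\<not> special (f x)" by (simp add: special_def)
    then have "c (f x) < 2" by (simp add: c_def)
    moreover have "c x = 2" using True by (simp add: c_def)
    ultimately show ?thesis by simp
  next
    case False
    \<comment> \<open>Off the orbit of the root, \<open>m\<close> drops by one and \<open>n\<close>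
      stays; on it, at a point that is not special, \<open>m\<close> stays 0 and \<open>n\<close>
      grows by one.\<close>
    have "m (f x) + n (f x) = Suc (m x + n x) \<or> Suc (m (f x) + n (f x)) = m x + n x"
    proof (cases "m x")
      case 0
      then have "f x = (f ^^ Suc (n x)) (r (f x))" using m[of x] by (simp add: r_f)
      then have "n (f x) \<le> Suc (n x)" using n_le[of 0 "f x"] by simp
      moreover have "n (f x) \<noteq> n x" using False 0 by (simp add: special_def)
      ultimately have n: "n (f x) = Suc (n x)" using n_mono[of x] by linarith
      then have "m (f x) = 0"
        using m_le[of 0 "f x"] \<open>f x = _\<close> by simp
      then show ?thesis using n 0 by simp
    next
      case (Suc k)
      then have k: "(f ^^ k) (f x) = (f ^^ n x) (r (f x))"
        using m[of x] by (simp add: r_f funpow_swap1)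
      then have n: "n (f x) = n x"
        using n_le n_mono[of x] le_antisym by blast
      then have "m (f x) \<le> k" using k m_le by simp
      moreover have "m x \<le> Suc (m (f x))"
        using m[of "f x"] n m_le[of "Suc (m (f x))" x] by (simp add: r_f funpow_swap1)
      ultimately show ?thesis using Suc n by simp
    qed
    moreover have "i mod 2 \<noteq> j mod 2" if "i = Suc j \<or> Suc i = j" for i j :: nat
      using that by (auto simp: mod_2_eq_odd)
    ultimately have "(m (f x) + n (f x)) mod 2 \<noteq> (m x + n x) mod 2" by blast
    moreover have "(m x + n x) mod 2 \<noteq> 2" by (metis mod_less_divisor less_irrefl zero_less_numeral)
    ultimately show ?thesis using False by (simp add: c_def)
  qed
  moreover have "c x < 3" for x
  proof -
    have "k mod 2 < 3" for k :: nat by presburger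
    then show ?thesis by (simp add: c_def)
  qed
  ultimately show ?thesis using that by blast
qed


section \<open>Ultrafilters and minimal left ideals\<close>

text \<open>Proper filters stand for nonempty closed sets of ultrafilters, a finer filter for a
  smaller set, so Zorn's lemma gives minimal closed invariant sets. With no maps the result is an
  ultrafilter; with all left translations it leads to a minimal left ideal.\<close>

lemma minimal_invariant_filter:
  assumes "F \<noteq> bot" and "\<And>f. f \<in> \<Phi> \<Longrightarrow> filtermap f F \<le> F"
  obtains G where "G \<noteq> bot" "G \<le> F" "\<And>f. f \<in> \<Phi> \<Longrightarrow> filtermap f G \<le> G"
    "\<And>G'. \<lbrakk>G' \<noteq> bot; G' \<le> G; \<And>f. f \<in> \<Phi> \<Longrightarrow> filtermap f G' \<le> G'\<rbrakk> \<Longrightarrow> G' = G"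
proof -
  let ?A = "{G. G \<noteq> bot \<and> G \<le> F \<and> (\<forall>f\<in>\<Phi>. filtermap f G \<le> G)}"
  have "\<exists>M\<in>?A. \<forall>G\<in>?A. G \<le> M \<longrightarrow> G = M"
  proof (rule predicate_Zorn)
    show "partial_order_on ?A (relation_of (\<lambda>G H. H \<le> G) ?A)"
      by (rule partial_order_on_relation_ofI) auto
  next
    fix C assume C: "C \<in> Chains (relation_of (\<lambda>G H. H \<le> G) ?A)"
    then have sub: "C \<subseteq> ?A" and tot: "\<And>G H. G \<in> C \<Longrightarrow> H \<in> C \<Longrightarrow> G \<le> H \<or> H \<le> G"
      by (auto simp: Chains_def relation_of_def)
    show "\<exists>U\<in>?A. \<forall>G\<in>C. U \<le> G"
    proof (cases "C = {}")
      case True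
      moreover have "F \<in> ?A" using assms by simp
      ultimately show ?thesis by blast
    next
      case False
      \<comment> \<open>A chain is closed under binary infima, so each property holding eventually
        for \<open>Inf C\<close> already does so for one member; hence \<open>Inf C\<close> is
        proper.\<close>
      have ev: "eventually P (Inf C) \<longleftrightarrow> (\<exists>G\<in>C. eventually P G)" for P
      proof (rule eventually_Inf_base[OF False])
        fix G H assume "G \<in> C" "H \<in> C"
        then have "inf G H \<in> C" using tot[of G H] by (auto simp: inf_absorb1 inf_absorb2)
        then show "\<exists>x\<in>C. x \<le> inf G H" by blast
      qed
      have "Inf C \<noteq> bot"
        using ev sub by (auto simp: trivial_limit_def)
      moreover have "Inf C \<le> F"
      proof -
        obtain G where "G \<in> C" using False by blast
        then show ?thesis using sub by (intro Inf_lower2[of G]) auto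
      qed
      moreover have "filtermap f (Inf C) \<le> Inf C" if "f \<in> \<Phi>" for f
      proof (rule Inf_greatest)
        fix G assume "G \<in> C"
        then have "filtermap f (Inf C) \<le> filtermap f G"
          by (intro filtermap_mono Inf_lower)
        also have "\<dots> \<le> G" using sub \<open>G \<in> C\<close> that by auto
        finally show "filtermap f (Inf C) \<le> G" .
      qed
      ultimately have "Inf C \<in> ?A" by blast
      then show ?thesis by (rule bexI[rotated]) (simp add: Inf_lower)
    qed
  qed
  then obtain M where M: "M \<in> ?A" and min: "\<And>G. G \<in> ?A \<Longrightarrow> G \<le> M \<Longrightarrow> G = M"
    by (elim bexE) simp
  show ?thesis
  proof (rule that[of M])
    fix G' assume "G' \<noteq> bot" "G' \<le> M" "\<And>f. f \<in> \<Phi> \<Longrightarrow> filtermap f G' \<le> G'"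
    then show "G' = M" using M by (intro min) auto
  qed (use M in auto)
qed

lemma filter_of_neq_bot [simp]: "filter_of p \<noteq> bot"
  using filter_of[of p] by simp

lemma eventually_filter_of_not:
  "eventually (\<lambda>x. \<not> P x) (filter_of p) \<longleftrightarrow> \<not> eventually P (filter_of p)"
proof
  assume "eventually (\<lambda>x. \<not> P x) (filter_of p)"
  then show "\<not> eventually P (filter_of p)"
    using eventually_happens'[OF filter_of_neq_bot eventually_conj] by blast
next
  assume "\<not> eventually P (filter_of p)"
  then show "eventually (\<lambda>x. \<not> P x) (filter_of p)"
    using filter_of[of p] by blast
qed

lemma filter_of_le_imp_eq:
  assumes "filter_of p \<le> filter_of q"
  shows "p = q"
proof -
  have "eventually P (filter_of p) \<longleftrightarrow> eventually P (filter_of q)" for P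
    using assms eventually_filter_of_not[of P] unfolding le_filter_def by blast
  then show ?thesis
    by (simp add: filter_eq_iff filter_of_inject[symmetric])
qed

text \<open>A minimal proper filter decides every \<open>P\<close>: restricting it to
  \<open>P\<close> gives either \<open>bot\<close> or the same filter.\<close>

lemma ex_ultrafilter_le:
  assumes "F \<noteq> bot"
  obtains p where "filter_of p \<le> F"
proof -
  obtain G where G: "G \<noteq> bot" "G \<le> F" and min: "\<And>G'. G' \<noteq> bot \<Longrightarrow> G' \<le> G \<Longrightarrow> G' = G"
    using minimal_invariant_filter[of F "{}"] assms by (metis empty_iff)
  have "eventually P G \<or> eventually (\<lambda>x. \<not> P x) G" for P
  proof (cases "inf G (principal {x. P x}) = bot")
    case True
    then show ?thesis
      by (simp add: trivial_limit_def eventually_inf_principal)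
  next
    case False
    then have "inf G (principal {x. P x}) = G" by (intro min) auto
    then have "G \<le> principal {x. P x}" by (metis inf_le2)
    then show ?thesis by (simp add: le_principal)
  qed
  then have "filter_of (Abs_ultrafilter G) = G"
    using G by (intro Abs_ultrafilter_inverse) simp
  then show ?thesis using that G by metis
qed

lemma eventually_filter_of_times:
  "eventually P (filter_of (p * q)) \<longleftrightarrow>
     eventually (\<lambda>s. eventually (\<lambda>t. P (s * t)) (filter_of q)) (filter_of p)"
  by (simp add: times_ultrafilter.rep_eq eventually_filter_times)

text \<open>Closed left ideals of the space of ultrafilters correspond to the filters that are invariant
  under left multiplication; a minimal one of these gives a minimal left ideal.\<close>

lemma ex_minimal_left_ideal:
  obtains L :: "'a::semigroup_mult ultrafilter set" where "minimal_left_ideal L"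
proof -
  obtain F :: "'a filter" where F: "F \<noteq> bot" and inv: "\<And>s. filtermap ((*) s) F \<le> F"
    and min: "\<And>G. \<lbrakk>G \<noteq> bot; G \<le> F; \<And>s. filtermap ((*) s) G \<le> G\<rbrakk> \<Longrightarrow> G = F"
  proof (rule minimal_invariant_filter[of top "range ((*) :: 'a \<Rightarrow> 'a \<Rightarrow> 'a)"])
    show "(top :: 'a filter) \<noteq> bot" by (simp add: trivial_limit_def)
  next
    fix G :: "'a filter" assume "G \<noteq> bot"
      and "\<And>f. f \<in> range (*) \<Longrightarrow> filtermap f G \<le> G"
      and min: "\<And>G'. \<lbrakk>G' \<noteq> bot; G' \<le> G; \<And>f. f \<in> range (*) \<Longrightarrow> filtermap f G' \<le> G'\<rbrakk> \<Longrightarrow> G' = G"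
    then show thesis by (intro that[of G]) auto
  qed simp
  have inv': "eventually (\<lambda>t. P (s * t)) F" if "eventually P F" for P s
    using inv[of s] that by (simp add: le_filter_def eventually_filtermap)
  define L where "L = {p. filter_of p \<le> F}"
  have "left_ideal L"
    unfolding left_ideal_def
  proof (intro conjI allI ballI)
    show "L \<noteq> {}" using ex_ultrafilter_le[OF F] by (auto simp: L_def)
  next
    fix q p assume "p \<in> L"
    then have "eventually P (filter_of (q * p))" if "eventually P F" for P
      using inv'[OF that] by (auto simp: eventually_filter_of_times L_def le_filter_def)
    then show "q * p \<in> L" by (simp add: L_def le_filter_def)
  qed
  moreover have "M = L" if M: "left_ideal M" "M \<subseteq> L" for M
  proof
    show "L \<subseteq> M"
    proof
      fix p assume p: "p \<in> L"
      from M obtain m where m: "m \<in> M" by (auto simp: left_ideal_def)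
      \<comment> \<open>The closed set of ultrafilters that \<open>G\<close> describes is the
        closure of all translates of \<open>m\<close> by points. It is invariant and lies inside
        \<open>L\<close>, so minimality identifies it with \<open>L\<close>.\<close>
      define G where "G = (SUP s. filtermap ((*) s) (filter_of m))"
      have ev_G: "eventually P G \<longleftrightarrow> (\<forall>s. eventually (\<lambda>t. P (s * t)) (filter_of m))" for P
        by (simp add: G_def eventually_Sup eventually_filtermap)
      have "G = F"
      proof (rule min)
        show "G \<noteq> bot" unfolding trivial_limit_def ev_G by simp
        show "G \<le> F"
          using m M inv' by (auto simp: le_filter_def ev_G L_def)
        show "filtermap ((*) s) G \<le> G" for s
          by (auto simp: le_filter_def eventually_filtermap ev_G mult.assoc[symmetric])
      qed
      \<comment> \<open>The filter \<open>Q\<close> is generated by the conditions on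
        \<open>q\<close> that force \<open>q * m = p\<close>; any ultrafilter below it solves this
        equation.\<close>
      define Q where "Q = Abs_filter (\<lambda>R. \<exists>P. eventually P (filter_of p) \<and>
        (\<forall>s. eventually (\<lambda>t. P (s * t)) (filter_of m) \<longrightarrow> R s))"
      have ev_Q: "eventually R Q \<longleftrightarrow> (\<exists>P. eventually P (filter_of p) \<and>
        (\<forall>s. eventually (\<lambda>t. P (s * t)) (filter_of m) \<longrightarrow> R s))" for R
        unfolding Q_def
      proof (rule eventually_Abs_filter, rule is_filter.intro)
        show "\<exists>P. eventually P (filter_of p) \<and>
          (\<forall>s. eventually (\<lambda>t. P (s * t)) (filter_of m) \<longrightarrow> True)"
          by (intro exI[of _ "\<lambda>_. True"]) simp
      next
        fix R R' assume "\<exists>P. eventually P (filter_of p) \<and>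
            (\<forall>s. eventually (\<lambda>t. P (s * t)) (filter_of m) \<longrightarrow> R s)"
          and "\<exists>P. eventually P (filter_of p) \<and>
            (\<forall>s. eventually (\<lambda>t. P (s * t)) (filter_of m) \<longrightarrow> R' s)"
        then obtain P P' where "eventually P (filter_of p)" "eventually P' (filter_of p)"
          and "\<And>s. eventually (\<lambda>t. P (s * t)) (filter_of m) \<Longrightarrow> R s"
          and "\<And>s. eventually (\<lambda>t. P' (s * t)) (filter_of m) \<Longrightarrow> R' s" by blast
        then show "\<exists>P. eventually P (filter_of p) \<and>
            (\<forall>s. eventually (\<lambda>t. P (s * t)) (filter_of m) \<longrightarrow> R s \<and> R' s)"
          by (intro exI[of _ "\<lambda>x. P x \<and> P' x"]) (auto simp: eventually_conj_iff)
      qed blast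
      \<comment> \<open>If \<open>Q\<close> were trivial, some \<open>P\<close> in \<open>p\<close>
        would fail in every translate of \<open>m\<close>, hence fail eventually in
        \<open>G = F\<close> and so in \<open>p\<close>.\<close>
      have "Q \<noteq> bot"
      proof
        assume "Q = bot"
        then obtain P where P: "eventually P (filter_of p)"
          and "\<And>s. \<not> eventually (\<lambda>t. P (s * t)) (filter_of m)"
          using ev_Q[of "\<lambda>_. False"] by auto
        then have "eventually (\<lambda>x. \<not> P x) G"
          by (simp add: ev_G eventually_filter_of_not)
        then have "eventually (\<lambda>x. \<not> P x) (filter_of p)"
          using p \<open>G = F\<close> by (auto simp: L_def le_filter_def)
        then show False using P by (simp add: eventually_filter_of_not)
      qed
      then obtain q where q: "filter_of q \<le> Q" by (rule ex_ultrafilter_le)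
      have "eventually P (filter_of (q * m))" if "eventually P (filter_of p)" for P
      proof -
        have "eventually (\<lambda>s. eventually (\<lambda>t. P (s * t)) (filter_of m)) Q"
          unfolding ev_Q using that by (intro exI[of _ P]) simp
        then show ?thesis using q by (simp add: le_filter_def eventually_filter_of_times)
      qed
      then have "q * m = p"
        by (intro filter_of_le_imp_eq) (simp add: le_filter_def)
      then show "p \<in> M" using M m by (auto simp: left_ideal_def)
    qed
  qed (fact M)
  ultimately have "minimal_left_ideal L"
    unfolding minimal_left_ideal_def by blast
  then show ?thesis by (rule that)
qed

section \<open>Existence of the smallest two-sided ideal\<close>

lemma smallest_ideal_eqI:
  assumes "two_sided_ideal I" and "\<And>J. two_sided_ideal J \<Longrightarrow> I \<subseteq> J"
  shows "smallest_ideal = I"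
  unfolding smallest_ideal_def using assms by (intro Least_equality) auto

text \<open>The \<open>LEAST\<close> is attained by the intersection of all two-sided ideals once
  this is nonempty. It contains \<open>L\<close>: for an ideal \<open>I\<close>, the set
  \<open>I \<inter> L\<close> contains a product \<open>i * l\<close>, so it is a left ideal inside
  \<open>L\<close> and equals \<open>L\<close>.\<close>

lemma two_sided_ideal_smallest_ideal:
  assumes L: "minimal_left_ideal (L :: 'a::semigroup_mult set)"
  shows "two_sided_ideal (smallest_ideal :: 'a set)"
proof -
  let ?K = "\<Inter> {I :: 'a set. two_sided_ideal I}"
  have "L \<subseteq> I" if I: "two_sided_ideal I" for I
  proof -
    obtain i l where "i \<in> I" "l \<in> L"
      using I L by (auto simp: two_sided_ideal_def left_ideal_def minimal_left_ideal_def)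
    then have "i * l \<in> I \<inter> L"
      using I L
      by (auto simp: two_sided_ideal_def left_ideal_def right_ideal_def minimal_left_ideal_def)
    then have "left_ideal (I \<inter> L)"
      using I L by (auto simp: two_sided_ideal_def left_ideal_def minimal_left_ideal_def)
    then show ?thesis using L by (auto simp: minimal_left_ideal_def)
  qed
  then have "L \<subseteq> ?K" by (intro Inter_greatest) simp
  moreover have "L \<noteq> {}" using L by (auto simp: minimal_left_ideal_def left_ideal_def)
  ultimately have "?K \<noteq> {}" by (metis subset_empty)
  then have K: "two_sided_ideal ?K"
    by (auto simp: two_sided_ideal_def left_ideal_def right_ideal_def)
  then have "smallest_ideal = ?K" by (rule smallest_ideal_eqI) blast
  then show ?thesis using K by simp
qed


section \<open>Right zeros\<close>

definition right_zeros :: "'a::semigroup_mult set" where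
  "right_zeros = {p. \<forall>q. q * p = p}"

text \<open>By associativity right zeros absorb multiplication on both sides. A two-sided ideal with
  an element \<open>j\<close> contains each right zero \<open>p\<close>, since
  \<open>p = j * p\<close>.\<close>

lemma smallest_ideal_eq_right_zeros:
  assumes "(right_zeros :: 'a::semigroup_mult set) \<noteq> {}"
  shows "smallest_ideal = (right_zeros :: 'a set)"
proof (rule smallest_ideal_eqI)
  show "two_sided_ideal (right_zeros :: 'a set)"
    using assms by (auto simp: two_sided_ideal_def left_ideal_def right_ideal_def right_zeros_def
        mult.assoc[symmetric])
next
  fix J :: "'a set" assume J: "two_sided_ideal J"
  show "right_zeros \<subseteq> J"
  proof
    fix p :: 'a assume p: "p \<in> right_zeros"
    obtain j where j: "j \<in> J" using J by (auto simp: two_sided_ideal_def left_ideal_def)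
    then have "j * p \<in> J" using J by (auto simp: two_sided_ideal_def right_ideal_def)
    then show "p \<in> J" using p by (simp add: right_zeros_def)
  qed
qed

text \<open>For \<open>l\<close> in \<open>L\<close>, the product \<open>p * l\<close> is unchanged
  by every left multiplication, so it alone forms a left ideal inside \<open>L\<close>.\<close>

lemma minimal_left_ideal_is_singleton:
  fixes p :: "'a::semigroup_mult"
  assumes "p \<in> right_zeros" and L: "minimal_left_ideal (L :: 'a set)"
  shows "is_singleton L"
proof -
  obtain l where l: "l \<in> L" using L by (auto simp: minimal_left_ideal_def left_ideal_def)
  have "left_ideal {p * l}"
    using assms by (simp add: left_ideal_def right_zeros_def mult.assoc[symmetric])
  moreover have "{p * l} \<subseteq> L" using L l by (auto simp: minimal_left_ideal_def left_ideal_def)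
  ultimately have "{p * l} = L" using L by (auto simp: minimal_left_ideal_def)
  then show ?thesis by (metis is_singletonI)
qed

lemma right_zeros_if_singleton_left_ideal:
  fixes L :: "'a::semigroup_mult set"
  assumes "left_ideal L" "is_singleton L"
  shows "(right_zeros :: 'a set) \<noteq> {}"
proof -
  obtain p where "L = {p}" using assms(2) by (auto simp: is_singleton_def)
  then have "p \<in> right_zeros" using assms(1) by (simp add: left_ideal_def right_zeros_def)
  then show ?thesis by blast
qed

text \<open>Absorption of all ultrafilters is reduced to invariance under translations by points of
  the semigroup, the form to which the colouring applies.\<close>

lemma right_zeros_ultrafilter_iff:
  fixes p :: "'a::semigroup_mult ultrafilter"
  shows "p \<in> right_zeros \<longleftrightarrow> (\<forall>s. filtermap ((*) s) (filter_of p) \<le> filter_of p)"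
proof
  assume p: "p \<in> right_zeros"
  show "\<forall>s. filtermap ((*) s) (filter_of p) \<le> filter_of p"
  proof
    fix s :: 'a
    \<comment> \<open>This \<open>q\<close> is the point \<open>s\<close> regarded as a principal
      ultrafilter.\<close>
    obtain q where q: "filter_of q \<le> principal {s}"
      using ex_ultrafilter_le[of "principal {s}"] by (auto simp: principal_eq_bot_iff)
    have "eventually (\<lambda>t. P (s * t)) (filter_of p)" if "eventually P (filter_of p)" for P
    proof -
      have "eventually P (filter_of (q * p))" using p that by (simp add: right_zeros_def)
      then have "eventually (\<lambda>r. eventually (\<lambda>t. P (r * t)) (filter_of p)) (filter_of q)"
        by (simp add: eventually_filter_of_times)
      moreover have "eventually (\<lambda>r. r = s) (filter_of q)"
        using q by (simp add: le_principal)
      ultimately show ?thesis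
        using eventually_happens'[OF filter_of_neq_bot eventually_conj] by fastforce
    qed
    then show "filtermap ((*) s) (filter_of p) \<le> filter_of p"
      by (simp add: le_filter_def eventually_filtermap)
  qed
next
  assume *: "\<forall>s. filtermap ((*) s) (filter_of p) \<le> filter_of p"
  have "q * p = p" for q
  proof (rule filter_of_le_imp_eq)
    show "filter_of (q * p) \<le> filter_of p"
      using * by (auto simp: le_filter_def eventually_filter_of_times eventually_filtermap)
  qed
  then show "p \<in> right_zeros" by (simp add: right_zeros_def)
qed

text \<open>Suppose \<open>f\<close> moves \<open>p\<close>-almost every point. If
  \<open>p\<close>-almost all points \<open>x\<close> had one colour, invariance would give
  \<open>f x\<close> the same colour, which the colouring forbids; but one of three classes must
  belong to \<open>p\<close>.\<close>

lemma eventually_fixed_point: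
  assumes "filtermap f (filter_of p) \<le> filter_of p"
  shows "eventually (\<lambda>x. f x = x) (filter_of p)"
proof (rule ccontr)
  assume "\<not> ?thesis"
  then have moved: "eventually (\<lambda>x. f x \<noteq> x) (filter_of p)"
    by (simp add: eventually_filter_of_not)
  obtain c :: "'a \<Rightarrow> nat" where c: "\<And>x. c x < 3" "\<And>x. f x \<noteq> x \<Longrightarrow> c (f x) \<noteq> c x"
    using three_colouring[of f] by blast
  have no: "\<not> eventually (\<lambda>x. c x = i) (filter_of p)" for i
  proof
    assume i: "eventually (\<lambda>x. c x = i) (filter_of p)"
    then have "eventually (\<lambda>x. c x = i) (filtermap f (filter_of p))"
      using assms by (rule filter_leD[rotated])
    then have "eventually (\<lambda>x. c (f x) = i) (filter_of p)"
      by (simp add: eventually_filtermap)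
    with i moved have "eventually (\<lambda>x. False) (filter_of p)"
      by eventually_elim (use c in auto)
    then show False by simp
  qed
  have "eventually (\<lambda>x. \<forall>i\<in>{..<3}. c x \<noteq> i) (filter_of p)"
    using no by (intro eventually_ball_finite) (auto simp: eventually_filter_of_not)
  then have "eventually (\<lambda>x. False) (filter_of p)"
    by eventually_elim (use c in auto)
  then show False by simp
qed

lemma eventually_fixed_right_zero:
  assumes "p \<in> right_zeros" "finite H"
  shows "eventually (\<lambda>x. \<forall>s\<in>H. s * x = x) (filter_of p)"
  using assms
  by (intro eventually_ball_finite) (auto simp: right_zeros_ultrafilter_iff intro: eventually_fixed_point)


section \<open>Common fixed points\<close>

definition common_fixed_points :: "'a::semigroup_mult itself \<Rightarrow> bool" where
  "common_fixed_points _ \<longleftrightarrow> (\<forall>H :: 'a set. finite H \<longrightarrow> (\<exists>z. \<forall>s\<in>H. s * z = z))"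

lemma finite_equalizer:
  fixes H :: "'a::semigroup_mult set"
  assumes "\<And>a b :: 'a. \<exists>x. a * x = b * x" and "finite H"
  shows "\<exists>x. \<forall>a\<in>H. \<forall>b\<in>H. a * x = b * x"
  using \<open>finite H\<close>
proof (induction H rule: finite_induct)
  case (insert h H)
  then obtain x where x: "\<And>a b. a \<in> H \<Longrightarrow> b \<in> H \<Longrightarrow> a * x = b * x" by blast
  show ?case
  proof (cases "H = {}")
    case False
    then obtain k where k: "k \<in> H" by blast
    \<comment> \<open>Comparing \<open>h\<close> with a single \<open>k\<close> is enough, because
      \<open>x\<close> already equalizes all of \<open>H\<close>.\<close>
    obtain y where y: "h * x * y = k * x * y" using assms(1) by blast
    have "a * (x * y) = k * (x * y)" if "a \<in> insert h H" for a
      using that x[of a k] k y by (auto simp: mult.assoc[symmetric])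
    then show ?thesis by metis
  qed auto
qed auto

text \<open>If \<open>x\<close> equalizes \<open>c\<close> with every \<open>s * c\<close>, then
  each \<open>s\<close> fixes \<open>c * x\<close>. The element \<open>c\<close> is arbitrary, so
  \<open>undefined\<close> serves.\<close>

lemma common_fixed_points_if_equalizers:
  assumes "\<And>H :: 'a::semigroup_mult set. finite H \<Longrightarrow> H \<noteq> {} \<Longrightarrow> \<exists>x. \<forall>a\<in>H. \<forall>b\<in>H. a * x = b * x"
  shows "common_fixed_points TYPE('a)"
  unfolding common_fixed_points_def
proof (intro allI impI)
  fix H :: "'a set" assume "finite H"
  define c :: 'a where "c = undefined"
  have "\<exists>x. \<forall>a\<in>insert c ((\<lambda>s. s * c) ` H). \<forall>b\<in>insert c ((\<lambda>s. s * c) ` H). a * x = b * x"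
    by (rule assms) (simp_all add: \<open>finite H\<close>)
  then obtain x
    where x: "\<forall>a\<in>insert c ((\<lambda>s. s * c) ` H). \<forall>b\<in>insert c ((\<lambda>s. s * c) ` H). a * x = b * x" ..
  have "s * (c * x) = c * x" if "s \<in> H" for s
    unfolding mult.assoc[symmetric]
    by (rule x[rule_format]) (use that in auto)
  then show "\<exists>z. \<forall>s\<in>H. s * z = z" by blast
qed

lemma common_fixed_points_iff_right_zeros:
  "common_fixed_points TYPE('a::semigroup_mult) \<longleftrightarrow> (right_zeros :: 'a ultrafilter set) \<noteq> {}"
proof
  assume fixed: "common_fixed_points TYPE('a)"
  let ?F = "INF s. principal {z :: 'a. s * z = z}"
  have "?F \<noteq> bot"
  proof
    assume "?F = bot"
    \<comment> \<open>Triviality of the filter generated by the fixed-point sets would be witnessed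
      by finitely many \<open>s\<close> without a common fixed point.\<close>
    then have "eventually (\<lambda>_. False) ?F" by simp
    then have "\<exists>X :: 'a set. X \<subseteq> UNIV \<and> finite X \<and>
        eventually (\<lambda>_. False) (INF s\<in>X. principal {z. s * z = z})"
      by (subst (asm) eventually_INF) assumption
    then obtain X :: "'a set" where X: "finite X"
      and "eventually (\<lambda>_. False) (INF s\<in>X. principal {z. s * z = z})"
      by (elim exE conjE)
    then have "eventually (\<lambda>_. False) (principal (\<Inter>s\<in>X. {z. s * z = z}))"
      by (subst (asm) INF_principal_finite)
    then have "\<nexists>z. \<forall>s\<in>X. s * z = z"
      by (auto simp only: eventually_principal)
    then show False
      using fixed X unfolding common_fixed_points_def by blast
  qed
  then obtain p where p: "filter_of p \<le> ?F" by (rule ex_ultrafilter_le)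
  have "p \<in> right_zeros"
    unfolding right_zeros_ultrafilter_iff
  proof
    fix s
    have "filter_of p \<le> principal {z. s * z = z}"
      using p by (rule order_trans) (rule INF_lower, simp)
    then have fixed: "eventually (\<lambda>z. s * z = z) (filter_of p)" by (simp add: le_principal)
    show "filtermap ((*) s) (filter_of p) \<le> filter_of p"
      unfolding le_filter_def eventually_filtermap
    proof (intro allI impI)
      fix P assume "eventually P (filter_of p)"
      with fixed show "eventually (\<lambda>z. P (s * z)) (filter_of p)"
        by eventually_elim simp
    qed
  qed
  then show "(right_zeros :: 'a ultrafilter set) \<noteq> {}" by blast
next
  assume "(right_zeros :: 'a ultrafilter set) \<noteq> {}"
  then obtain p :: "'a ultrafilter" where "p \<in> right_zeros" by blast
  then show "common_fixed_points TYPE('a)"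
    unfolding common_fixed_points_def
    using eventually_happens'[OF filter_of_neq_bot eventually_fixed_right_zero] by blast
qed


section \<open>Folner density\<close>

text \<open>This is the condition under the supremum for a single \<open>\<alpha>\<close>, with the
  restriction to [0,1] left outside.\<close>

definition density_ge :: "'a::semigroup_mult set \<Rightarrow> real \<Rightarrow> bool" where
  "density_ge A \<alpha> \<longleftrightarrow> (\<forall>H \<epsilon>. finite H \<and> H \<noteq> {} \<and> \<epsilon> > 0 \<longrightarrow>
     (\<exists>K. folner_set H \<epsilon> K \<and> real (card (A \<inter> K)) \<ge> \<alpha> * real (card K)))"

lemma folner_density_alt:
  "folner_density A = Sup {\<alpha>. 0 \<le> \<alpha> \<and> \<alpha> \<le> 1 \<and> density_ge A \<alpha>}"
  by (simp add: folner_density_def density_ge_def)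

lemma folner_set_mono:
  assumes "folner_set H \<epsilon> K" "H' \<subseteq> H" "\<epsilon> \<le> \<epsilon>'"
  shows "folner_set H' \<epsilon>' K"
  using assms unfolding folner_set_def
  by (meson less_le_trans mult_right_mono of_nat_0_le_iff subsetD)

text \<open>This makes the set under the supremum nonempty, so that \<open>Sup\<close> can be
  bounded above and approximated from below.\<close>

lemma density_ge_0:
  assumes "strong_folner_condition TYPE('a::semigroup_mult)"
  shows "density_ge (A :: 'a set) 0"
  using assms by (auto simp: strong_folner_condition_def density_ge_def)

lemma folner_density_ge:
  assumes "density_ge A \<alpha>" "0 \<le> \<alpha>" "\<alpha> \<le> 1"
  shows "\<alpha> \<le> folner_density A"
  unfolding folner_density_alt using assms by (intro cSup_upper bdd_aboveI[of _ 1]) auto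

lemma folner_density_le_1:
  assumes "strong_folner_condition TYPE('a::semigroup_mult)"
  shows "folner_density (A :: 'a set) \<le> 1"
  unfolding folner_density_alt using density_ge_0[OF assms, of A]
  by (intro cSup_least) force+

lemma less_folner_densityE:
  assumes "strong_folner_condition TYPE('a::semigroup_mult)" and "\<beta> < folner_density (A :: 'a set)"
  obtains \<alpha> where "\<beta> < \<alpha>" "\<alpha> \<le> 1" "density_ge A \<alpha>"
  using assms(2) density_ge_0[OF assms(1), of A] unfolding folner_density_alt
  by (elim less_cSupE) force+

lemma folner_density_pos_or_0:
  assumes "strong_folner_condition TYPE('a::semigroup_mult)"
  shows "folner_density (A :: 'a set) = 0 \<or> 0 < folner_density A"
  using folner_density_ge[OF density_ge_0[OF assms, of A]] by auto

lemma folner_density_UNIV: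
  assumes "strong_folner_condition TYPE('a::semigroup_mult)"
  shows "folner_density (UNIV :: 'a set) \<noteq> 0"
proof -
  have "density_ge (UNIV :: 'a set) 1"
    using assms by (auto simp: strong_folner_condition_def density_ge_def)
  then show ?thesis using folner_density_ge[of UNIV 1] by fastforce
qed

lemma folner_density_eq_0D:
  assumes "folner_density A = 0" "0 < \<alpha>" "\<alpha> \<le> 1"
  obtains H \<epsilon> where "finite H" "H \<noteq> {}" "\<epsilon> > 0"
    "\<And>K. folner_set H \<epsilon> K \<Longrightarrow> real (card (A \<inter> K)) < \<alpha> * real (card K)"
proof -
  have "\<not> density_ge A \<alpha>" using folner_density_ge[of A \<alpha>] assms by auto
  then show ?thesis using that by (auto simp: density_ge_def not_le)
qed

section \<open>Null sets, and sets displaced by a translation\<close>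

lemma folner_density_Un_eq_0:
  fixes A B :: "'a::semigroup_mult set"
  assumes sfc: "strong_folner_condition TYPE('a)"
    and A: "folner_density A = 0" and B: "folner_density B = 0"
  shows "folner_density (A \<union> B) = 0"
proof (rule ccontr)
  assume "folner_density (A \<union> B) \<noteq> 0"
  then have "0 < folner_density (A \<union> B)" using folner_density_pos_or_0[OF sfc] by blast
  then obtain \<alpha> where \<alpha>: "0 < \<alpha>" "\<alpha> \<le> 1" "density_ge (A \<union> B) \<alpha>"
    using less_folner_densityE[OF sfc] by metis
  obtain H \<epsilon> where H: "finite H" "H \<noteq> {}" "\<epsilon> > 0"
    "\<And>K. folner_set H \<epsilon> K \<Longrightarrow> real (card (A \<inter> K)) < \<alpha> / 2 * real (card K)"
    using folner_density_eq_0D[OF A, of "\<alpha> / 2"] \<alpha> by auto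
  obtain H' \<epsilon>' where H': "finite H'" "H' \<noteq> {}" "\<epsilon>' > 0"
    "\<And>K. folner_set H' \<epsilon>' K \<Longrightarrow> real (card (B \<inter> K)) < \<alpha> / 2 * real (card K)"
    using folner_density_eq_0D[OF B, of "\<alpha> / 2"] \<alpha> by auto
  \<comment> \<open>A Folner set for the joint requirements has less than half of the proportion
    \<open>\<alpha>\<close> in each of \<open>A\<close> and \<open>B\<close>, yet at least
    \<open>\<alpha>\<close> in their union.\<close>
  obtain K where K: "folner_set (H \<union> H') (min \<epsilon> \<epsilon>') K"
    and le: "\<alpha> * real (card K) \<le> real (card ((A \<union> B) \<inter> K))"
    using \<alpha>(3) H H' unfolding density_ge_def by (metis finite_Un min_less_iff_conj sup_eq_bot_iff)
  have "real (card (A \<inter> K)) < \<alpha> / 2 * real (card K)"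
    by (rule H(4)) (rule folner_set_mono[OF K], auto)
  moreover have "real (card (B \<inter> K)) < \<alpha> / 2 * real (card K)"
    by (rule H'(4)) (rule folner_set_mono[OF K], auto)
  moreover have "card ((A \<union> B) \<inter> K) \<le> card (A \<inter> K) + card (B \<inter> K)"
    by (simp add: Int_Un_distrib2 card_Un_le)
  ultimately show False using le by (simp add: field_simps)
qed

text \<open>If \<open>A\<close> filled more than 3/4 of a Folner set \<open>K\<close> with error
  1/4, the points of \<open>A\<close> in \<open>a K\<close> would have to come from the less than
  1/4 of \<open>K\<close> outside \<open>A\<close>. Together with the less than 1/4 of
  \<open>K\<close> outside \<open>a K\<close>, this leaves too little room.\<close>

lemma folner_density_displaced:
  fixes A :: "'a::semigroup_mult set"
  assumes sfc: "strong_folner_condition TYPE('a)"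
    and disj: "\<And>x. x \<in> A \<Longrightarrow> a * x \<notin> A"
  shows "folner_density A \<noteq> 1"
proof
  assume "folner_density A = 1"
  then have "3/4 < folner_density A" by simp
  then obtain \<alpha> where \<alpha>: "3/4 < \<alpha>" "density_ge A \<alpha>"
    using less_folner_densityE[OF sfc] by metis
  then obtain K where K: "folner_set {a} (1/4) K" and ge: "\<alpha> * real (card K) \<le> real (card (A \<inter> K))"
    unfolding density_ge_def
    by (metis finite.emptyI finite.insertI insert_not_empty zero_less_divide_1_iff zero_less_numeral)
  have fin: "finite K" and pos: "card K > 0"
    and less: "real (card (K - (*) a ` K)) < 1/4 * real (card K)"
    using K by (auto simp: folner_set_def card_gt_0_iff)
  have "3/4 * real (card K) < \<alpha> * real (card K)" using \<alpha> pos by simp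
  then have ge': "3/4 * real (card K) < real (card (A \<inter> K))" using ge by linarith
  \<comment> \<open>A point \<open>a * k\<close> of \<open>A\<close> with \<open>k\<close> in
    \<open>K\<close> has \<open>k\<close> outside \<open>A\<close>.\<close>
  have "A \<inter> K \<subseteq> (K - (*) a ` K) \<union> (*) a ` (K - A)"
    using disj by auto
  then have "card (A \<inter> K) \<le> card ((K - (*) a ` K) \<union> (*) a ` (K - A))"
    using fin by (intro card_mono) auto
  also have "\<dots> \<le> card (K - (*) a ` K) + card ((*) a ` (K - A))" by (rule card_Un_le)
  also have "\<dots> \<le> card (K - (*) a ` K) + card (K - A)"
    using fin by (simp add: card_image_le)
  finally have "card (A \<inter> K) \<le> card (K - (*) a ` K) + card (K - A)" .
  moreover have "card (A \<inter> K) + card (K - A) = card K"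
    using card_Int_Diff[OF fin, of A] by (simp add: Int_commute)
  ultimately show False using less ge' by linarith
qed

text \<open>Within the moved points, translation by \<open>a\<close> carries each of the three
  colour classes off itself. Its density is therefore not 1, hence 0, and null sets are closed under
  union.\<close>

lemma folner_density_moved_eq_0:
  fixes a :: "'a::semigroup_mult"
  assumes sfc: "strong_folner_condition TYPE('a)"
    and d01: "\<And>A :: 'a set. folner_density A \<in> {0, 1}"
  shows "folner_density {x. a * x \<noteq> x} = 0"
proof -
  obtain c :: "'a \<Rightarrow> nat" where c: "\<And>x. c x < 3" "\<And>x. a * x \<noteq> x \<Longrightarrow> c (a * x) \<noteq> c x"
    using three_colouring[of "(*) a"] by blast
  define A where "A i = {x. a * x \<noteq> x \<and> c x = i}" for i
  have null: "folner_density (A i) = 0" for i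
  proof -
    have "folner_density (A i) \<noteq> 1"
      by (rule folner_density_displaced[OF sfc, of _ a]) (use c(2) in \<open>force simp: A_def\<close>)
    then show ?thesis using d01[of "A i"] by simp
  qed
  have "{x. a * x \<noteq> x} = A 0 \<union> A 1 \<union> A 2"
    using c(1) by (auto simp: A_def numeral_3_eq_3 numeral_2_eq_2 less_Suc_eq)
  then show ?thesis using null folner_density_Un_eq_0[OF sfc] by simp
qed

text \<open>The points moved by \<open>a\<close> or by \<open>b\<close> form a null set, and the
  whole semigroup is not null; a remaining point is fixed by both.\<close>

lemma equalizer_if_density_0_or_1:
  fixes a b :: "'a::semigroup_mult"
  assumes sfc: "strong_folner_condition TYPE('a)"
    and d01: "\<And>A :: 'a set. folner_density A \<in> {0, 1}"
  shows "\<exists>x. a * x = b * x"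
proof -
  have "folner_density ({x. a * x \<noteq> x} \<union> {x. b * x \<noteq> x}) = 0"
    using assms by (intro folner_density_Un_eq_0 folner_density_moved_eq_0)
  then have "{x. a * x \<noteq> x} \<union> {x. b * x \<noteq> x} \<noteq> UNIV"
    using folner_density_UNIV[OF sfc] by metis
  then obtain x where "x \<notin> {x. a * x \<noteq> x} \<union> {x. b * x \<noteq> x}" by blast
  then show ?thesis by (auto intro!: exI[of _ x])
qed

section \<open>Density and \<open>Delta\<close> in the presence of common fixed points\<close>

lemma folner_set_fixed_singleton:
  assumes "\<forall>s\<in>H. s * z = z" "\<epsilon> > 0"
  shows "folner_set H \<epsilon> {z}"
  using assms by (auto simp: folner_set_def)

lemma strong_folner_condition_if_common_fixed_points:
  assumes "common_fixed_points TYPE('a::semigroup_mult)"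
  shows "strong_folner_condition TYPE('a)"
  using assms folner_set_fixed_singleton
  unfolding strong_folner_condition_def common_fixed_points_def by blast

lemma folner_density_eq_1I:
  fixes A :: "'a::semigroup_mult set"
  assumes sfc: "strong_folner_condition TYPE('a)"
    and fixed: "\<And>H. finite H \<Longrightarrow> \<exists>z\<in>A. \<forall>s\<in>H. s * z = z"
  shows "folner_density A = 1"
proof -
  have "density_ge A 1"
    unfolding density_ge_def
  proof (intro allI impI)
    fix H :: "'a set" and \<epsilon> :: real assume H: "finite H \<and> H \<noteq> {} \<and> \<epsilon> > 0"
    then obtain z where "z \<in> A" "\<forall>s\<in>H. s * z = z" using fixed by blast
    then show "\<exists>K. folner_set H \<epsilon> K \<and> 1 * real (card K) \<le> real (card (A \<inter> K))"
      using H by (intro exI[of _ "{z}"]) (simp add: folner_set_fixed_singleton)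
  qed
  then show ?thesis using folner_density_ge[of A 1] folner_density_le_1[OF sfc, of A] by simp
qed

lemma fixed_point_if_folner_density_pos:
  fixes A :: "'a::semigroup_mult set"
  assumes cfp: "common_fixed_points TYPE('a)"
    and pos: "0 < folner_density A" and "finite H"
  shows "\<exists>x\<in>A. \<forall>s\<in>H. s * x = x"
proof -
  obtain \<alpha> where \<alpha>: "0 < \<alpha>" "density_ge A \<alpha>"
    using less_folner_densityE[OF strong_folner_condition_if_common_fixed_points[OF cfp] pos] by metis
  obtain z where z: "\<forall>s\<in>H. s * z = z"
    using cfp \<open>finite H\<close> by (auto simp: common_fixed_points_def)
  \<comment> \<open>Near-invariance is requested under the fixed point \<open>z\<close> itself, with
    the density bound \<open>\<alpha>\<close> as error: then \<open>K\<close> has fewer points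
    outside \<open>z K\<close> than in \<open>A\<close>, so \<open>A\<close> meets
    \<open>z K\<close>.\<close>
  obtain K where K: "folner_set {z} \<alpha> K" and ge: "\<alpha> * real (card K) \<le> real (card (A \<inter> K))"
    using \<alpha> unfolding density_ge_def by (metis finite.emptyI finite.insertI insert_not_empty)
  then have fin: "finite K" and "card (K - (*) z ` K) < card (A \<inter> K)"
    by (auto simp: folner_set_def)
  then have "\<not> A \<inter> K \<subseteq> K - (*) z ` K"
    using card_mono[of "K - (*) z ` K" "A \<inter> K"] by auto
  then obtain k where "z * k \<in> A" by blast
  then show ?thesis using z by (auto simp: mult.assoc[symmetric] intro!: bexI[of _ "z * k"])
qed

text \<open>If \<open>p\<close> were not invariant under \<open>s\<close>, some member of
  \<open>p\<close> would contain no fixed point of \<open>s\<close>, although its density is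
  positive. Conversely, the common fixed points of a finite set are \<open>p\<close>-almost
  everything for a right zero \<open>p\<close>, so every member of \<open>p\<close> contains some
  and has density 1.\<close>

lemma Delta_eq_right_zeros:
  assumes cfp: "common_fixed_points TYPE('a::semigroup_mult)"
  shows "(Delta :: 'a ultrafilter set) = right_zeros"
proof (intro set_eqI iffI)
  fix p :: "'a ultrafilter" assume p: "p \<in> Delta"
  show "p \<in> right_zeros"
    unfolding right_zeros_ultrafilter_iff le_filter_def eventually_filtermap
  proof (intro allI impI, rule ccontr)
    fix s P assume "eventually P (filter_of p)"
      and "\<not> eventually (\<lambda>x. P (s * x)) (filter_of p)"
    then have "{x. P x \<and> \<not> P (s * x)} \<in> members p"
      by (simp add: members_def eventually_conj_iff eventually_filter_of_not)
    then have "0 < folner_density {x. P x \<and> \<not> P (s * x)}"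
      using p by (simp add: Delta_def)
    then show False
      using fixed_point_if_folner_density_pos[OF cfp, of _ "{s}"] by fastforce
  qed
next
  fix p :: "'a ultrafilter" assume p: "p \<in> right_zeros"
  have "folner_density A = 1" if "A \<in> members p" for A
  proof (rule folner_density_eq_1I)
    show "strong_folner_condition TYPE('a)"
      by (rule strong_folner_condition_if_common_fixed_points) (fact cfp)
  next
    fix H :: "'a set" assume "finite H"
    moreover have "eventually (\<lambda>x. x \<in> A) (filter_of p)" using that by (simp add: members_def)
    ultimately show "\<exists>z\<in>A. \<forall>s\<in>H. s * z = z"
      using eventually_happens'[OF filter_of_neq_bot eventually_conj[OF _ eventually_fixed_right_zero[OF p]]]
      by blast
  qed
  then show "p \<in> Delta" by (simp add: Delta_def)
qed

lemma density_0_or_1_if_common_fixed_points: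
  fixes A :: "'a::semigroup_mult set"
  assumes cfp: "common_fixed_points TYPE('a)"
  shows "folner_density A \<in> {0, 1}"
proof -
  have sfc: "strong_folner_condition TYPE('a)"
    using cfp by (rule strong_folner_condition_if_common_fixed_points)
  show ?thesis
    using folner_density_pos_or_0[OF sfc, of A] folner_density_eq_1I[OF sfc, of A]
      fixed_point_if_folner_density_pos[OF cfp, of A] by blast
qed

section \<open>Assembling the equivalences around common fixed points\<close>

theorem theorem4p6:
  "let
     s1 = (\<forall>a b :: 'a::semigroup_mult. \<exists>x. a * x = b * x);
     s2 = (\<forall>H :: 'a set. finite H \<and> H \<noteq> {} \<longrightarrow> (\<exists>x. \<forall>a\<in>H. \<forall>b\<in>H. a * x = b * x));
     s3 = (\<forall>L :: 'a ultrafilter set. minimal_left_ideal L \<longrightarrow> is_singleton L);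
     s4 = (\<forall>p \<in> (smallest_ideal :: 'a ultrafilter set). \<forall>q. q * p = p);
     s5 = (\<forall>p \<in> (smallest_ideal :: 'a ultrafilter set). right_zero_of smallest_ideal p);
     s6 = (strong_folner_condition TYPE('a) \<and> (\<forall>A :: 'a set. folner_density A \<in> {0, 1}));
     s7 = (\<forall>p \<in> (smallest_ideal :: 'a ultrafilter set). p * p = p);
     s8 = (strong_folner_condition TYPE('a) \<and> (smallest_ideal :: 'a ultrafilter set) = Delta)
   in (s1 \<longleftrightarrow> s2) \<and> (s1 \<longleftrightarrow> s3) \<and> (s1 \<longleftrightarrow> s4) \<and> (s1 \<longleftrightarrow> s5) \<and> (s1 \<longleftrightarrow> s6) \<and>
      (s1 \<or> s2 \<or> s3 \<or> s4 \<or> s5 \<or> s6 \<longrightarrow> s7 \<and> s8)"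
proof -
  define s1 where "s1 \<longleftrightarrow> (\<forall>a b :: 'a. \<exists>x. a * x = b * x)"
  define s2 where "s2 \<longleftrightarrow> (\<forall>H :: 'a set. finite H \<and> H \<noteq> {} \<longrightarrow> (\<exists>x. \<forall>a\<in>H. \<forall>b\<in>H. a * x = b * x))"
  define s3 where "s3 \<longleftrightarrow> (\<forall>L :: 'a ultrafilter set. minimal_left_ideal L \<longrightarrow> is_singleton L)"
  define s4 where "s4 \<longleftrightarrow> (\<forall>p \<in> (smallest_ideal :: 'a ultrafilter set). \<forall>q. q * p = p)"
  define s5 where "s5 \<longleftrightarrow>
    (\<forall>p \<in> (smallest_ideal :: 'a ultrafilter set). right_zero_of smallest_ideal p)"
  define s6 where "s6 \<longleftrightarrow>
    strong_folner_condition TYPE('a) \<and> (\<forall>A :: 'a set. folner_density A \<in> {0, 1})"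
  define s7 where "s7 \<longleftrightarrow> (\<forall>p \<in> (smallest_ideal :: 'a ultrafilter set). p * p = p)"
  define s8 where "s8 \<longleftrightarrow>
    strong_folner_condition TYPE('a) \<and> (smallest_ideal :: 'a ultrafilter set) = Delta"
  let ?C = "common_fixed_points TYPE('a)"
  \<comment> \<open>The ideal \<open>L\<close> and the element \<open>p\<close> of the smallest
    ideal keep \<open>s3\<close>, \<open>s4\<close> and \<open>s5\<close> from holding
    vacuously.\<close>
  obtain L :: "'a ultrafilter set" where L: "minimal_left_ideal L"
    by (rule ex_minimal_left_ideal)
  have K: "two_sided_ideal (smallest_ideal :: 'a ultrafilter set)"
    using L by (rule two_sided_ideal_smallest_ideal)
  then obtain p :: "'a ultrafilter" where p: "p \<in> smallest_ideal"
    by (auto simp: two_sided_ideal_def left_ideal_def)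
  have "s1 \<longrightarrow> s2" unfolding s1_def s2_def using finite_equalizer by blast
  moreover have "s2 \<longrightarrow> ?C" unfolding s2_def using common_fixed_points_if_equalizers by blast
  moreover have "?C \<longrightarrow> s1"
  proof (unfold s1_def, intro impI allI)
    fix a b :: 'a assume ?C
    then obtain z where "\<forall>s\<in>{a, b}. s * z = z"
      unfolding common_fixed_points_def by (meson finite.emptyI finite.insertI)
    then show "\<exists>x. a * x = b * x" by (intro exI[of _ z]) simp
  qed
  moreover have "?C \<longrightarrow> s3 \<and> s4 \<and> s5 \<and> s6 \<and> s7 \<and> s8"
  proof
    assume C: ?C
    then have ne: "(right_zeros :: 'a ultrafilter set) \<noteq> {}"
      by (simp add: common_fixed_points_iff_right_zeros)
    then have eq: "smallest_ideal = (right_zeros :: 'a ultrafilter set)"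
      by (rule smallest_ideal_eq_right_zeros)
    have s3 unfolding s3_def using ne minimal_left_ideal_is_singleton by blast
    moreover have s4 s5 s7
      by (auto simp: s4_def s5_def s7_def eq right_zero_of_def right_zeros_def)
    moreover have s6
      using C strong_folner_condition_if_common_fixed_points density_0_or_1_if_common_fixed_points
      unfolding s6_def by blast
    moreover have s8
      using C strong_folner_condition_if_common_fixed_points
      by (simp add: s8_def eq Delta_eq_right_zeros)
    ultimately show "s3 \<and> s4 \<and> s5 \<and> s6 \<and> s7 \<and> s8" by blast
  qed
  moreover have "s3 \<longrightarrow> ?C"
    using L right_zeros_if_singleton_left_ideal[of L]
    by (auto simp: s3_def minimal_left_ideal_def common_fixed_points_iff_right_zeros)
  moreover have "s4 \<longrightarrow> ?C"
    using p by (auto simp: s4_def common_fixed_points_iff_right_zeros right_zeros_def)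
  moreover have "s5 \<longrightarrow> s4"
  proof (unfold s4_def, intro impI ballI allI)
    fix r q :: "'a ultrafilter" assume s5 and r: "r \<in> smallest_ideal"
    then have rz: "\<And>x. x \<in> smallest_ideal \<Longrightarrow> x * r = r" by (simp add: s5_def right_zero_of_def)
    \<comment> \<open>An arbitrary \<open>q\<close> is moved into the ideal by multiplying with
      \<open>p\<close>; there \<open>r\<close> absorbs both \<open>q * p\<close> and
      \<open>p\<close>, hence also \<open>q\<close>.\<close>
    have "q * p \<in> smallest_ideal"
      using K p by (auto simp: two_sided_ideal_def left_ideal_def)
    then have "q * (p * r) = r" using rz by (simp add: mult.assoc[symmetric])
    then show "q * r = r" using rz p by simp
  qed
  moreover have "s6 \<longrightarrow> s1"
    unfolding s6_def s1_def using equalizer_if_density_0_or_1 by blast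
  ultimately show ?thesis
    unfolding Let_def s1_def[symmetric] s2_def[symmetric] s3_def[symmetric] s4_def[symmetric]
      s5_def[symmetric] s6_def[symmetric] s7_def[symmetric] s8_def[symmetric]
    by blast
qed

end
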